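(* Let $d$ be a positive integer, let $p \ge q \ge 2d$ be positive integers and let $1 > \delta > 0$. Then there is a positive integer $c = c(p,q,d,\delta)$, depending only on $p,q,d,\delta$, such that the following holds. Let $\mathcal{F}$ be any finite family of at least $p$ convex sets in $\mathbb{R}^d$, each of diameter at least one, such that out of every $p$ sets in $\mathcal{F}$ there are $q$ of them whose intersection has diameter at least one. Then there are $c$ convex sets $K_1, K_2, \ldots, K_c$ in $\mathbb{R}^d$, each of diameter at least $1-\delta$, such that every set in $\mathcal{F}$ contains at least one $K_i$.
   Context: The diameter $\operatorname{diam}(X)$ of a set $X\subset\mathbb{R}^d$ is the supremum of Euclidean distances between two of its points; the empty set does not have diameter at least any positive number. *)

theory Defs
  imports "HOL-Analysis.Analysis"
begin

text \<open>
  The library's real-valued \<open>diameter\<close> is unspecified on unbounded sets, so the diameter is taken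
  in \<open>ennreal\<close> here; an unbounded set has diameter \<open>\<infinity>\<close> and the empty set has diameter 0.
\<close>

definition ediameter :: "'a::metric_space set \<Rightarrow> ennreal" where
  "ediameter X = (SUP (x, y)\<in>X \<times> X. ennreal (dist x y))"

end

theory Submission imports Defs begin

text \<open>
  Fix a finite \<open>\<delta>/2\<close>-net \<open>V\<close> of unit directions. A convex set of diameter at least 1 contains, for
  some \<open>v \<in> V\<close>, a segment whose extent in direction \<open>v\<close> is exactly \<open>1 - \<delta>\<close>, and the segments of
  this kind inside \<open>A\<close> form a convex subset of a space of dimension \<open>2d - 1\<close>. So it suffices to
  prove a \<open>(p,q)\<close> theorem with Helly number \<open>2d\<close> for points of finitely many kinds \<open>v\<close>.

  By the \<open>(p,q)\<close> condition, any \<open>2dp\<close> members of the family, with repetitions, include \<open>2d\<close> whose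
  sets of some kind \<open>v\<close> have a common point. The point of least norm of that intersection is already
  determined by \<open>2d - 1\<close> of the \<open>2d\<close> sets, so averaging over all tuples yields, for any weights on
  the family, a point that lies in sets of at least a constant fraction of the weight. Iterating
  with multiplicatively updated weights gives a sequence of points of which every member of the
  family contains a constant fraction, and a weak \<open>\<epsilon>\<close>-net for this sequence (one per kind) is a
  transversal of bounded size.
\<close>

section \<open>Many convex sets through one point\<close>

text \<open>
  If no index could be dropped, Radon's theorem, applied to the points of least norm of the partial
  intersections together with that of the full one, would give a point of the full intersection of
  smaller norm.
\<close>
lemma closest_point_Inter_drop:
  fixes C :: "'i \<Rightarrow> 'a::euclidean_space set"
  assumes "finite I" "2 \<le> card I" "dim S < card I"
    and C: "\<And>i. i \<in> I \<Longrightarrow> closed (C i) \<and> convex (C i) \<and> C i \<subseteq> S"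
    and ne: "(\<Inter>i\<in>I. C i) \<noteq> {}"
  shows "\<exists>i\<in>I. closest_point (\<Inter>k\<in>I - {i}. C k) 0 \<in> C i"
proof (rule ccontr)
  assume contra: "\<not> ?thesis"
  define D where "D i = (\<Inter>k\<in>I - {i}. C k)" for i
  define z where "z i = closest_point (D i) 0" for i
  define a where "a = closest_point (\<Inter>i\<in>I. C i) 0"
  have nz: "z i \<notin> C i" if "i \<in> I" for i
    using contra that by (auto simp: z_def D_def)
  have cl: "closed (\<Inter>i\<in>I. C i)" using C by auto
  have a: "a \<in> C i" if "i \<in> I" for i
    using closest_point_in_set[OF cl ne] that by (auto simp: a_def)
  have amin: "norm a \<le> norm y" if "\<And>i. i \<in> I \<Longrightarrow> y \<in> C i" for y
    using closest_point_le[OF cl, of y 0] that by (auto simp: a_def dist_norm)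
  have clD: "closed (D i)" "convex (D i)" for i
    using C by (auto simp: D_def intro!: convex_Inter)
  have aD: "a \<in> D i" for i
    using a by (auto simp: D_def)
  have zD: "z i \<in> D i" for i
    unfolding z_def using clD aD by (intro closest_point_in_set) auto
  have zC: "z i \<in> C k" if "k \<in> I" "k \<noteq> i" for i k
    using zD[of i] that by (auto simp: D_def)
  have zlt: "norm (z i) < norm a" if "i \<in> I" for i
  proof -
    have le: "norm (z i) \<le> norm y" if "y \<in> D i" for y
      using closest_point_le[OF clD(1) that, of 0] by (simp add: z_def dist_norm)
    have "norm (z i) \<noteq> norm a"
    proof
      assume "norm (z i) = norm a"
      then have "\<forall>y\<in>D i. dist 0 a \<le> dist 0 y" using le by (simp add: dist_norm)
      then have "a = z i" unfolding z_def
        by (intro closest_point_unique clD aD)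
      then show False using a nz that by metis
    qed
    with le[OF aD] show ?thesis by simp
  qed
  have inj: "inj_on z I"
    by (metis inj_onI nz zC)
  have anz: "a \<notin> z ` I" using zlt by force
  define Z where "Z = insert a (z ` I)"
  have cZ: "card Z = card I + 1"
    using assms(1) anz inj by (simp add: Z_def card_image)
  have "Z \<subseteq> S"
  proof -
    have "a \<in> S" using a C assms(2) by (metis card.empty not_numeral_le_zero subsetD equals0I)
    moreover have "z i \<in> S" if "i \<in> I" for i
    proof -
      have "card (I - {i}) \<noteq> 0" using assms(1,2) that by simp
      then have "I - {i} \<noteq> {}" by (metis card.empty)
      then obtain k where "k \<in> I" "k \<noteq> i" by auto
      then show ?thesis using zC C by blast
    qed
    ultimately show ?thesis by (auto simp: Z_def)
  qed
  \<comment> \<open>\<open>Z\<close> has \<open>card I + 1\<close> points and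
    \<open>dim S < card I\<close>, so there are at least \<open>dim S + 2\<close> of them: enough
    for a Radon partition.\<close>
  then have "dim Z \<le> dim S" by (rule dim_subset)
  then have "affine_dependent Z"
    using assms(1,3) cZ by (intro affine_dependent_biggerset_general) (auto simp: Z_def)
  then obtain M P where MP: "M \<subseteq> Z" "P \<subseteq> Z" "M \<inter> P = {}" "convex hull M \<inter> convex hull P \<noteq> {}"
    using Radon by blast
  \<comment> \<open>At most one Radon part contains \<open>a\<close>. Up to swapping
    \<open>M\<close> and \<open>P\<close>, all points of \<open>M\<close> are of the form
    \<open>z i\<close>, so the hull of \<open>M\<close> lies in the open ball of radius
    \<open>norm a\<close>.\<close>
  have False if MP: "M \<subseteq> Z" "P \<subseteq> Z" "M \<inter> P = {}" "convex hull M \<inter> convex hull P \<noteq> {}" "a \<notin> M" for M P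
  proof -
    obtain r where r: "r \<in> convex hull M" "r \<in> convex hull P" using MP by auto
    \<comment> \<open>The only point of \<open>Z\<close> outside \<open>C k\<close> is
      \<open>z k\<close>, and it belongs to at most one Radon part; the hull of the other part lies
      in \<open>C k\<close>.\<close>
    have hullC: "convex hull Q \<subseteq> C k" if "k \<in> I" "Q \<subseteq> Z" "z k \<notin> Q" for k Q
    proof (rule hull_minimal)
      show "Q \<subseteq> C k"
      proof
        fix y assume "y \<in> Q"
        then show "y \<in> C k" using that a zC by (cases "y = a") (force simp: Z_def)+
      qed
    qed (use C that in auto)
    have "r \<in> C k" if "k \<in> I" for k
    proof (cases "z k \<in> M")
      case True
      then have "z k \<notin> P" using MP by auto
      then show ?thesis using hullC[OF that] MP r by blast
    next
      case False
      then show ?thesis using hullC[OF that] MP r by blast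
    qed
    then have "norm a \<le> norm r" by (rule amin)
    moreover have "convex hull M \<subseteq> ball 0 (norm a)"
      using MP zlt by (intro hull_minimal) (auto simp: Z_def)
    ultimately show False using r by (auto simp: dist_norm)
  qed
  from this[of M P] this[of P M] MP show False by blast
qed

lemma pigeonhole_card:
  assumes "finite T" "finite A" "\<And>a. a \<in> A \<Longrightarrow> \<exists>t\<in>T. R a t" "A \<noteq> {}"
  shows "\<exists>t\<in>T. card A \<le> card T * card {a\<in>A. R a t}"
proof (rule ccontr)
  assume "\<not> ?thesis"
  then have *: "card T * card {a\<in>A. R a t} < card A" if "t \<in> T" for t using that by auto
  have "card A \<le> (\<Sum>t\<in>T. card {a\<in>A. R a t})"
  proof -
    have "A = (\<Union>t\<in>T. {a\<in>A. R a t})" using assms(3) by blast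
    then show ?thesis using card_UN_le[OF assms(1)] by metis
  qed
  then have "card T * card A \<le> (\<Sum>t\<in>T. card T * card {a\<in>A. R a t})"
    by (simp add: sum_distrib_left[symmetric])
  also have "\<dots> < (\<Sum>t\<in>T. card A)"
    using * assms by (intro sum_strict_mono) auto
  finally show False by simp
qed

text \<open>Double counting over all tuples \<open>f\<close>. Each supplies a triple
  \<open>(v, i, I)\<close> for which the least-norm point of the sets at \<open>I - {i}\<close> also
  lies in \<open>C v (f i)\<close>. Fix a frequent triple, then frequent values of \<open>f\<close>
  off \<open>i\<close>: this determines the point, and the surviving tuples differ only at
  \<open>i\<close>, where each lists a set containing it. The constant counts the triples.\<close>

lemma exists_heavy_point:
  fixes C :: "'v \<Rightarrow> 'u \<Rightarrow> 'a::euclidean_space set"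
  assumes U: "finite U" "U \<noteq> {}" and V: "finite V" and N: "2 \<le> N"
    and C: "\<And>v u. v \<in> V \<Longrightarrow> u \<in> U \<Longrightarrow> closed (C v u) \<and> convex (C v u) \<and> C v u \<subseteq> S v"
    and S: "\<And>v. v \<in> V \<Longrightarrow> dim (S v) < N"
    and hyp: "\<And>f. f \<in> {..<m} \<rightarrow> U \<Longrightarrow>
      \<exists>I\<subseteq>{..<m}. card I = N \<and> (\<exists>v\<in>V. (\<Inter>i\<in>I. C v (f i)) \<noteq> {})"
  shows "\<exists>v\<in>V. \<exists>z. card U \<le> (card V * m * 2 ^ m) * card {u\<in>U. z \<in> C v u}"
proof -
  define cp where "cp v I i f = closest_point (\<Inter>k\<in>I - {i}. C v (f k)) 0" for v I i and f :: "nat \<Rightarrow> 'u"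
  define \<Omega> where "\<Omega> = {..<m} \<rightarrow>\<^sub>E U"
  define T where "T = V \<times> {..<m} \<times> Pow {..<m}"
  define R where "R f = (\<lambda>(v, i, I). cp v I i f \<in> C v (f i))" for f
  have fin: "finite \<Omega>" "finite T" using U V by (auto simp: \<Omega>_def T_def finite_PiE)
  have "\<exists>t\<in>T. R f t" if "f \<in> \<Omega>" for f
  proof -
    have f: "f \<in> {..<m} \<rightarrow> U" using that by (auto simp: \<Omega>_def)
    from hyp[OF f] obtain I v where I: "I \<subseteq> {..<m}" "card I = N" "v \<in> V" "(\<Inter>i\<in>I. C v (f i)) \<noteq> {}"
      by blast
    have "\<exists>i\<in>I. closest_point (\<Inter>k\<in>I - {i}. C v (f k)) 0 \<in> C v (f i)"
    proof (rule closest_point_Inter_drop)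
      show "finite I" using I(1) finite_subset by blast
      show "closed (C v (f i)) \<and> convex (C v (f i)) \<and> C v (f i) \<subseteq> S v" if "i \<in> I" for i
        using C[OF I(3)] f I(1) that by blast
    qed (use I N S in auto)
    then obtain i where "i \<in> I" "cp v I i f \<in> C v (f i)" by (auto simp: cp_def)
    then show ?thesis using I by (intro bexI[of _ "(v, i, I)"]) (auto simp: R_def T_def)
  qed
  moreover have "\<Omega> \<noteq> {}" using U by (auto simp: \<Omega>_def PiE_eq_empty_iff)
  ultimately obtain t where t: "t \<in> T" "card \<Omega> \<le> card T * card {f\<in>\<Omega>. R f t}"
    using pigeonhole_card[OF fin(2,1)] by blast
  obtain v i I where tt: "t = (v, i, I)" "v \<in> V" "i < m" "I \<subseteq> {..<m}"
    using t(1) by (auto simp: T_def)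
  define \<Omega>' where "\<Omega>' = {f\<in>\<Omega>. R f t}"
  define G where "G = ({..<m} - {i}) \<rightarrow>\<^sub>E U"
  have G: "finite G" "card G = card U ^ (m - 1)"
    using U tt(3) by (auto simp: G_def finite_PiE card_PiE)
  have "0 < card \<Omega>" using fin \<open>\<Omega> \<noteq> {}\<close> by (simp add: card_gt_0_iff)
  then have "\<Omega>' \<noteq> {}" using t(2) unfolding \<Omega>'_def by (metis card.empty mult_0_right not_le)
  have "\<exists>g\<in>G. card \<Omega>' \<le> card G * card {f\<in>\<Omega>'. restrict f ({..<m} - {i}) = g}"
  proof (rule pigeonhole_card)
    show "\<exists>g\<in>G. restrict f ({..<m} - {i}) = g" if "f \<in> \<Omega>'" for f
      using that by (auto simp: G_def \<Omega>'_def \<Omega>_def)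
  qed (use fin G \<open>\<Omega>' \<noteq> {}\<close> in \<open>auto simp: \<Omega>'_def\<close>)
  then obtain g where g: "g \<in> G" "card \<Omega>' \<le> card G * card {f\<in>\<Omega>'. restrict f ({..<m} - {i}) = g}"
    by blast
  define z where "z = cp v I i g"
  have cpg: "cp v I i f = z" if "restrict f ({..<m} - {i}) = g" for f
  proof -
    have "f k = g k" if "k \<in> I - {i}" for k
      using \<open>restrict f _ = g\<close> tt(4) that by (auto simp: restrict_def)
    then show ?thesis unfolding z_def cp_def by (metis (no_types, lifting) INF_cong)
  qed
  have "card {f\<in>\<Omega>'. restrict f ({..<m} - {i}) = g} \<le> card {u\<in>U. z \<in> C v u}"
  proof (rule card_inj_on_le[where f = "\<lambda>f. f i"])
    show "inj_on (\<lambda>f. f i) {f\<in>\<Omega>'. restrict f ({..<m} - {i}) = g}"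
    proof (rule inj_onI, clarsimp)
      fix f h assume fh: "f \<in> \<Omega>'" "h \<in> \<Omega>'" "f i = h i"
        "restrict h ({..<m} - {i}) = restrict f ({..<m} - {i})"
      have "f k = h k" for k
      proof (cases "k \<in> {..<m} - {i}")
        case True
        then show ?thesis using fun_cong[OF fh(4), of k] by simp
      next
        case False
        then show ?thesis using fh by (cases "k = i") (auto simp: \<Omega>'_def \<Omega>_def PiE_def extensional_def)
      qed
      then show "f = h" by blast
    qed
    show "(\<lambda>f. f i) ` {f\<in>\<Omega>'. restrict f ({..<m} - {i}) = g} \<subseteq> {u\<in>U. z \<in> C v u}"
      using cpg tt by (auto simp: \<Omega>'_def R_def \<Omega>_def)
  qed (use U in auto)
  from g(2)[unfolded G(2)] this have "card \<Omega>' \<le> card U ^ (m - 1) * card {u\<in>U. z \<in> C v u}"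
    by (rule order_trans[OF _ mult_le_mono2])
  from t(2)[folded \<Omega>'_def] this have "card \<Omega> \<le> card T * (card U ^ (m - 1) * card {u\<in>U. z \<in> C v u})"
    by (rule order_trans[OF _ mult_le_mono2])
  moreover have "card \<Omega> = card U ^ (m - 1) * card U"
    using tt(3) U by (simp add: \<Omega>_def card_PiE flip: power_Suc2)
  moreover have "0 < card U ^ (m - 1)" using U by (simp add: card_gt_0_iff)
  ultimately have "card U \<le> card T * card {u\<in>U. z \<in> C v u}"
    using U by (simp add: mult.left_commute mult.commute[of _ "card U"] card_gt_0_iff)
  moreover have "card T = card V * m * 2 ^ m"
    by (simp add: T_def card_cartesian_product card_Pow)
  ultimately show ?thesis using tt(2) by auto
qed

section \<open>Multiplicative weights\<close>

text \<open>The sum is a potential in which every hit halves the weight of a member. By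
  \<open>hyp\<close> the next point can be chosen to hit at least \<open>1 / L\<close> of the
  current potential, and halving that part removes at least a fraction
  \<open>1 / (2 * L)\<close>.\<close>

lemma multiplicative_weights_step:
  fixes hit :: "'x \<Rightarrow> 'b \<Rightarrow> bool" and L :: nat
  assumes F: "finite F" "F \<noteq> {}" and L: "0 < L"
    and hyp: "\<And>w :: 'b \<Rightarrow> nat. 0 < sum w F \<Longrightarrow> \<exists>x. sum w F \<le> L * sum w {A\<in>F. hit x A}"
  shows "\<exists>x :: nat \<Rightarrow> 'x. (\<Sum>A\<in>F. (1/2) ^ card {t. t < T \<and> hit (x t) A}) \<le> card F * (1 - 1 / (2 * real L)) ^ T"
proof (induction T)
  case 0
  then show ?case by simp
next
  case (Suc T)
  then obtain x :: "nat \<Rightarrow> 'x" where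
    x: "(\<Sum>A\<in>F. (1/2) ^ card {t. t < T \<and> hit (x t) A}) \<le> card F * (1 - 1 / (2 * real L)) ^ T" by blast
  define h where "h A = card {t. t < T \<and> hit (x t) A}" for A
  have hT: "h A \<le> T" for A
    unfolding h_def using card_mono[of "{..<T}" "{t. t < T \<and> hit (x t) A}"] by auto
  \<comment> \<open>\<open>hyp\<close> takes natural-number weights, so \<open>(1/2) ^ h A\<close>
    is scaled by \<open>2 ^ T\<close>.\<close>
  define w where "w A = (2::nat) ^ (T - h A)" for A
  have w: "real (w A) = 2 ^ T * (1/2) ^ h A" for A
  proof -
    have "(2::real) ^ T = 2 ^ (T - h A) * 2 ^ h A" using hT[of A] by (simp flip: power_add)
    then show ?thesis by (simp add: w_def power_divide)
  qed
  have "0 < sum w F" using F by (intro sum_pos) (auto simp: w_def)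
  from hyp[OF this] obtain y where y: "sum w F \<le> L * sum w {A\<in>F. hit y A}" by blast
  define x' where "x' = x(T := y)"
  define g where "g A = (1/2::real) ^ h A" for A
  have h': "(1/2::real) ^ card {t. t < Suc T \<and> hit (x' t) A} = (if hit y A then g A / 2 else g A)" for A
  proof -
    have "{t. t < Suc T \<and> hit (x' t) A} =
      (if hit y A then insert T {t. t < T \<and> hit (x t) A} else {t. t < T \<and> hit (x t) A})"
      by (auto simp: x'_def less_Suc_eq)
    then show ?thesis by (auto simp: h_def g_def)
  qed
  have "real (sum w F) \<le> real L * real (sum w {A\<in>F. hit y A})"
    using y by (metis of_nat_le_iff of_nat_mult)
  then have "2 ^ T * sum g F \<le> real L * (2 ^ T * sum g {A\<in>F. hit y A})"
    by (simp add: w g_def sum_distrib_left)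
  then have gy: "sum g F \<le> real L * sum g {A\<in>F. hit y A}"
    by (simp add: mult.left_commute)
  have "(\<Sum>A\<in>F. (1/2::real) ^ card {t. t < Suc T \<and> hit (x' t) A})
      = (\<Sum>A\<in>F. g A - (if hit y A then g A / 2 else 0))"
    unfolding h' by (intro sum.cong) auto
  also have "\<dots> = sum g F - sum g {A\<in>F. hit y A} / 2"
    using F by (simp add: sum_subtractf sum.If_cases sum_divide_distrib Int_def)
  also have "\<dots> \<le> (1 - 1 / (2 * real L)) * sum g F"
    using gy L by (simp add: field_simps)
  also have "\<dots> \<le> (1 - 1 / (2 * real L)) * (card F * (1 - 1 / (2 * real L)) ^ T)"
    using x L by (intro mult_left_mono) (auto simp: g_def h_def)
  finally show ?case by (intro exI[of _ x']) (simp add: mult_ac)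
qed

text \<open>A member hit \<open>h\<close> times alone contributes \<open>(1/2) ^ h\<close> to the
  potential. If \<open>2 * L * h < T\<close>, raising the bound to the power \<open>2 * L\<close>
  gives \<open>(1/2) ^ T \<le> ?n ^ (2 * L) * exp (- 1) ^ T\<close>, which fails for large
  \<open>T\<close> because \<open>exp 1 > 2\<close>.\<close>

lemma multiplicative_weights:
  fixes hit :: "'x \<Rightarrow> 'b \<Rightarrow> bool" and L :: nat
  assumes F: "finite F" "F \<noteq> {}" and L: "0 < L"
    and hyp: "\<And>w :: 'b \<Rightarrow> nat. 0 < sum w F \<Longrightarrow> \<exists>x. sum w F \<le> L * sum w {A\<in>F. hit x A}"
  shows "\<exists>T>0. \<exists>x :: nat \<Rightarrow> 'x. \<forall>A\<in>F. T \<le> 2 * L * card {t. t < T \<and> hit (x t) A}"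
proof -
  let ?n = "real (card F)"
  have "1 < exp 1 / (2::real)" using exp_lower_Taylor_quadratic[of "1::real"] by simp
  then obtain T0 where "?n ^ (2 * L) < (exp 1 / 2) ^ T0" using real_arch_pow by blast
  \<comment> \<open>The successor guarantees \<open>T > 0\<close>; the bound survives since the base
    exceeds 1.\<close>
  moreover define T where "T = Suc T0"
  ultimately have T: "?n ^ (2 * L) < (exp 1 / 2) ^ T" using \<open>1 < exp 1 / (2::real)\<close>
    by (smt (verit) lessI power_strict_increasing)
  obtain x :: "nat \<Rightarrow> 'x" where x: "(\<Sum>A\<in>F. (1/2) ^ card {t. t < T \<and> hit (x t) A}) \<le> ?n * (1 - 1 / (2 * real L)) ^ T"
    using multiplicative_weights_step[OF F L hyp] by blast
  have "T \<le> 2 * L * card {t. t < T \<and> hit (x t) A}" if A: "A \<in> F" for A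
  proof (rule ccontr)
    define h where "h = card {t. t < T \<and> hit (x t) A}"
    assume "\<not> ?thesis"
    then have hT: "2 * L * h < T" by (simp add: h_def)
    have "(1/2::real) ^ h \<le> (\<Sum>A\<in>F. (1/2) ^ card {t. t < T \<and> hit (x t) A})"
      unfolding h_def using A F by (intro member_le_sum) auto
    also note x
    finally have "((1/2::real) ^ h) ^ (2 * L) \<le> (?n * (1 - 1 / (2 * real L)) ^ T) ^ (2 * L)"
      by (intro power_mono) auto
    also have "\<dots> = ?n ^ (2 * L) * ((1 - 1 / (2 * real L)) ^ (2 * L)) ^ T"
      by (simp add: power_mult_distrib mult.commute flip: power_mult)
    also have "\<dots> \<le> ?n ^ (2 * L) * (exp (- 1)) ^ T"
    proof -
      have "1 - 1 / (2 * real L) \<le> exp (- (1 / (2 * real L)))"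
        using exp_ge_add_one_self[of "- (1 / (2 * real L))"] by simp
      moreover have "0 \<le> 1 - 1 / (2 * real L)" using L by simp
      ultimately have "(1 - 1 / (2 * real L)) ^ (2 * L) \<le> exp (- (1 / (2 * real L))) ^ (2 * L)"
        by (rule power_mono)
      also have "\<dots> = exp (- 1)" using L by (simp flip: exp_of_nat_mult)
      finally show ?thesis using \<open>0 \<le> 1 - 1 / (2 * real L)\<close>
        by (intro mult_left_mono power_mono) auto
    qed
    also have "\<dots> < (exp 1 / 2) ^ T * (exp (- 1)) ^ T"
      using T by (intro mult_strict_right_mono) auto
    also have "\<dots> = (1/2) ^ T"
      by (simp add: exp_minus flip: power_mult_distrib)
    also have "\<dots> \<le> (1/2) ^ (2 * L * h)"
      using hT by (intro power_decreasing) auto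
    also have "\<dots> = ((1/2) ^ h) ^ (2 * L)"
      by (simp add: mult.commute flip: power_mult)
    finally show False by simp
  qed
  then show ?thesis by (intro exI[of _ T]) (auto simp: T_def)
qed

section \<open>Weak nets for convex sets\<close>

text \<open>
  Weak \<open>\<epsilon>\<close>-nets of size \<open>N\<close> for point sets that vary only in the coordinates in \<open>B\<close>, which
  is what makes an induction on the dimension possible inside a single type.
\<close>
definition weak_net_bound :: "'a::euclidean_space set \<Rightarrow> real \<Rightarrow> nat \<Rightarrow> bool" where
  "weak_net_bound B \<epsilon> N \<longleftrightarrow> (\<forall>P w. finite P \<and> (\<forall>x\<in>P. 0 \<le> w x) \<and> sum w P \<le> 1 \<and>
     (\<forall>x\<in>P. \<forall>y\<in>P. \<forall>b\<in>Basis - B. x \<bullet> b = y \<bullet> b) \<longrightarrow>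
     (\<exists>X. finite X \<and> card X \<le> N \<and> (\<forall>C. convex C \<and> \<epsilon> \<le> sum w (P \<inter> C) \<longrightarrow> C \<inter> X \<noteq> {})))"

lemma weak_net_boundD:
  assumes "weak_net_bound B \<epsilon> N" "finite P" "\<And>x. x \<in> P \<Longrightarrow> 0 \<le> w x" "sum w P \<le> 1"
    "\<And>x y b. x \<in> P \<Longrightarrow> y \<in> P \<Longrightarrow> b \<in> Basis - B \<Longrightarrow> x \<bullet> b = y \<bullet> b"
  obtains X where "finite X" "card X \<le> N"
    "\<And>C. convex C \<Longrightarrow> \<epsilon> \<le> sum w (P \<inter> C) \<Longrightarrow> C \<inter> X \<noteq> {}"
  using assms unfolding weak_net_bound_def by metis

text \<open>Take for \<open>m\<close> the least value of \<open>g\<close> with at most half of the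
  weight above it. The next smaller value \<open>c\<close> has more than half above it, which leaves
  less than half for the points below \<open>m\<close>.\<close>

lemma weighted_median:
  fixes g :: "'a \<Rightarrow> real"
  assumes P: "finite P" and w: "\<And>x. x \<in> P \<Longrightarrow> 0 \<le> w x" and le1: "sum w P \<le> 1"
  obtains m where "sum w {x\<in>P. g x < m} \<le> 1/2" "sum w {x\<in>P. m < g x} \<le> (1/2::real)"
proof (cases "P = {}")
  case True
  then show ?thesis using that[of 0] by simp
next
  case False
  define M where "M = {c \<in> g ` P. sum w {x\<in>P. c < g x} \<le> 1/2}"
  have "Max (g ` P) \<in> M"
  proof -
    have "{x\<in>P. Max (g ` P) < g x} = {}" using P by (auto simp: not_less)
    then have "sum w {x\<in>P. Max (g ` P) < g x} = 0" by (metis sum.empty)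
    then show ?thesis using P False by (simp add: M_def)
  qed
  then have M: "finite M" "M \<noteq> {}" using P by (auto simp: M_def)
  define m where "m = Min M"
  have "m \<in> M" using M by (simp add: m_def)
  moreover have "sum w {x\<in>P. g x < m} \<le> 1/2"
  proof (cases "{x\<in>P. g x < m} = {}")
    case True
    then show ?thesis by (metis sum.empty zero_le_divide_1_iff zero_le_numeral)
  next
    case ne: False
    define c where "c = Max (g ` {x\<in>P. g x < m})"
    have fin: "finite (g ` {x\<in>P. g x < m})" using P by auto
    have "c \<in> g ` {x\<in>P. g x < m}" unfolding c_def using fin ne by (intro Max_in) auto
    then have c: "c \<in> g ` P" "c < m" by auto
    have cge: "g x \<le> c" if "x \<in> P" "g x < m" for x
      unfolding c_def using fin that by (intro Max_ge) auto
    have "c \<notin> M" using c(2) M by (auto simp: m_def)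
    then have "1/2 < sum w {x\<in>P. c < g x}" using c by (auto simp: M_def)
    moreover have "sum w {x\<in>P. g x < m} + sum w {x\<in>P. c < g x} = sum w ({x\<in>P. g x < m} \<union> {x\<in>P. c < g x})"
      using P by (intro sum.union_disjoint[symmetric]) (auto dest: cge leD)
    moreover have "\<dots> \<le> sum w P"
      using P w by (intro sum_mono2) auto
    ultimately show ?thesis using le1 by linarith
  qed
  ultimately show ?thesis using that by (auto simp: M_def)
qed

lemma closed_segment_crossing:
  fixes x y b :: "'a::real_inner"
  assumes "x \<bullet> b \<le> m" "m \<le> y \<bullet> b"
  obtains r where "r \<in> closed_segment x y" "r \<bullet> b = m"
proof -
  have "connected ((\<lambda>z. z \<bullet> b) ` closed_segment x y)"
    by (intro connected_continuous_image continuous_intros) auto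
  then have "m \<in> (\<lambda>z. z \<bullet> b) ` closed_segment x y"
    using assms connectedD_interval[of _ "x \<bullet> b" "y \<bullet> b" m] by blast
  then show ?thesis using that by auto
qed

text \<open>
  Cut by the median hyperplane orthogonal to \<open>b\<close>. A convex set that has little weight on one closed side
  has density at least \<open>3/2 * \<epsilon>\<close> within the other open side. Otherwise it contains many of the segments
  that cross the hyperplane, hence many of the crossing points, which span one dimension less.
\<close>
lemma weak_net_bound_step:
  fixes B :: "'a::euclidean_space set"
  assumes N1: "weak_net_bound (insert b B) (3/2 * \<epsilon>) N1"
    and N0: "weak_net_bound B (\<epsilon>\<^sup>2 / 16) N0" and \<epsilon>: "0 < \<epsilon>"
  shows "weak_net_bound (insert b B) \<epsilon> (N1 + N1 + N0)"
  unfolding weak_net_bound_def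
proof (intro allI impI, elim conjE)
  fix P :: "'a set" and w :: "'a \<Rightarrow> real"
  assume P: "finite P" and w: "\<forall>x\<in>P. 0 \<le> w x" and le1: "sum w P \<le> 1"
    and eq: "\<forall>x\<in>P. \<forall>y\<in>P. \<forall>b'\<in>Basis - insert b B. x \<bullet> b' = y \<bullet> b'"
  obtain m where m: "sum w {x\<in>P. x \<bullet> b < m} \<le> 1/2" "sum w {x\<in>P. m < x \<bullet> b} \<le> 1/2"
    by (rule weighted_median[of P w "\<lambda>x. x \<bullet> b"]) (use P w le1 in auto)
  \<comment> \<open>Doubling the weights on a part of total at most \<open>1/2\<close> keeps them
    admissible, so a net for threshold \<open>3/2 * \<epsilon>\<close> catches sets of original
    weight \<open>3/4 * \<epsilon>\<close>.\<close>
  have half: "\<exists>X. finite X \<and> card X \<le> N1 \<and> (\<forall>C. convex C \<and> 3/4 * \<epsilon> \<le> sum w (Q \<inter> C) \<longrightarrow> C \<inter> X \<noteq> {})"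
    if Q: "Q \<subseteq> P" "sum w Q \<le> 1/2" for Q
  proof -
    obtain X where X: "finite X" "card X \<le> N1"
      "\<And>C. convex C \<Longrightarrow> 3/2 * \<epsilon> \<le> (\<Sum>x\<in>Q \<inter> C. 2 * w x) \<Longrightarrow> C \<inter> X \<noteq> {}"
    proof (rule weak_net_boundD[OF N1, of Q "\<lambda>x. 2 * w x"])
      show "finite Q" using Q P finite_subset by blast
      show "(\<Sum>x\<in>Q. 2 * w x) \<le> 1" using Q by (simp flip: sum_distrib_left)
      show "x \<bullet> b' = y \<bullet> b'" if "x \<in> Q" "y \<in> Q" "b' \<in> Basis - insert b B" for x y b'
        using eq that Q by blast
    qed (use w Q in auto)
    then show ?thesis by (intro exI[of _ X]) (simp flip: sum_distrib_left)
  qed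
  obtain X1 where X1: "finite X1" "card X1 \<le> N1"
    "\<And>C. convex C \<Longrightarrow> 3/4 * \<epsilon> \<le> sum w ({x\<in>P. x \<bullet> b < m} \<inter> C) \<Longrightarrow> C \<inter> X1 \<noteq> {}"
    using half[OF _ m(1)] by blast
  obtain X2 where X2: "finite X2" "card X2 \<le> N1"
    "\<And>C. convex C \<Longrightarrow> 3/4 * \<epsilon> \<le> sum w ({x\<in>P. m < x \<bullet> b} \<inter> C) \<Longrightarrow> C \<inter> X2 \<noteq> {}"
    using half[OF _ m(2)] by blast
  define P1 where "P1 = {x\<in>P. x \<bullet> b \<le> m}"
  define P2 where "P2 = {x\<in>P. m \<le> x \<bullet> b}"
  have fin12: "finite P1" "finite P2" using P by (auto simp: P1_def P2_def)
  have w12: "x \<in> P1 \<Longrightarrow> 0 \<le> w x" "x \<in> P2 \<Longrightarrow> 0 \<le> w x" for x using w by (auto simp: P1_def P2_def)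
  have "\<exists>r. r \<in> closed_segment x y \<and> r \<bullet> b = m" if "x \<in> P1" "y \<in> P2" for x y
    using closed_segment_crossing[of x b m y] that unfolding P1_def P2_def by blast
  then obtain r where r: "\<And>x y. x \<in> P1 \<Longrightarrow> y \<in> P2 \<Longrightarrow> r x y \<in> closed_segment x y \<and> r x y \<bullet> b = m"
    by metis
  define \<rho> where "\<rho> = (\<lambda>(x, y). r x y)"
  define ww where "ww = (\<lambda>(x, y). w x * w y)"
  define Q where "Q = \<rho> ` (P1 \<times> P2)"
  \<comment> \<open>The product weight is pushed forward along \<open>\<rho>\<close>: several pairs
    may share a crossing point, so their weights are added.\<close>
  define w' where "w' z = sum ww {t \<in> P1 \<times> P2. \<rho> t = z}" for z
  have ww0: "0 \<le> ww t" if "t \<in> P1 \<times> P2" for t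
    using that w12 by (auto simp: ww_def)
  have ww_prod: "sum ww (D1 \<times> D2) = sum w D1 * sum w D2" for D1 D2
    by (simp add: ww_def sum_product sum.cartesian_product)
  have w'_sum: "sum w' (Q \<inter> C) = sum ww {t \<in> P1 \<times> P2. \<rho> t \<in> C}" for C
  proof -
    have fin: "finite {t \<in> P1 \<times> P2. \<rho> t \<in> C}" using fin12 by auto
    have "sum ww {t \<in> P1 \<times> P2. \<rho> t \<in> C} =
      (\<Sum>z\<in>\<rho> ` {t \<in> P1 \<times> P2. \<rho> t \<in> C}. sum ww {t \<in> {t \<in> P1 \<times> P2. \<rho> t \<in> C}. \<rho> t = z})"
      by (rule sum.image_gen[OF fin])
    also have "\<dots> = sum w' (Q \<inter> C)"
      unfolding w'_def Q_def by (intro sum.cong arg_cong[where f = "sum ww"]) auto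
    finally show ?thesis by simp
  qed
  have sub1: "sum w P1 \<le> 1" "sum w P2 \<le> 1"
    using sum_mono2[of P P1 w] sum_mono2[of P P2 w] P w le1 by (auto simp: P1_def P2_def)
  obtain X0 where X0: "finite X0" "card X0 \<le> N0"
    "\<And>C. convex C \<Longrightarrow> \<epsilon>\<^sup>2 / 16 \<le> sum w' (Q \<inter> C) \<Longrightarrow> C \<inter> X0 \<noteq> {}"
  proof (rule weak_net_boundD[OF N0, of Q w'])
    show "finite Q" using fin12 by (simp add: Q_def)
    show "0 \<le> w' z" for z unfolding w'_def using ww0 by (intro sum_nonneg) auto
    have "sum w' Q = sum w P1 * sum w P2"
      using w'_sum[of UNIV] by (simp add: ww_prod)
    also have "\<dots> \<le> 1"
      using sub1 w12 by (intro mult_le_one sum_nonneg) auto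
    finally show "sum w' Q \<le> 1" .
    \<comment> \<open>Crossing points are affine combinations of points of \<open>P\<close>, so they
      keep the coordinates on which \<open>P\<close> is constant. Their \<open>b\<close>-coordinate
      is always \<open>m\<close>, which leaves only \<open>B\<close> free.\<close>
    have coord: "z \<bullet> b' = u \<bullet> b'" if zu: "z \<in> Q" "u \<in> P" "b' \<in> Basis - insert b B" for z u b'
    proof -
      obtain x y where xy: "x \<in> P1" "y \<in> P2" "z = r x y"
        using zu(1) by (auto simp: Q_def \<rho>_def)
      obtain s where s: "r x y = (1 - s) *\<^sub>R x + s *\<^sub>R y"
        using r[OF xy(1,2)] by (auto simp: in_segment)
      have "x \<in> P" "y \<in> P" using xy by (auto simp: P1_def P2_def)
      then have xu: "x \<bullet> b' = u \<bullet> b'" and yu: "y \<bullet> b' = u \<bullet> b'"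
        using eq zu by blast+
      have "z \<bullet> b' = (1 - s) * (u \<bullet> b') + s * (u \<bullet> b')"
        unfolding xy(3) s inner_add_left inner_scaleR_left xu yu ..
      then show ?thesis by (simp add: left_diff_distrib)
    qed
    show "z \<bullet> b' = z' \<bullet> b'" if zz: "z \<in> Q" "z' \<in> Q" "b' \<in> Basis - B" for z z' b'
    proof (cases "b' = b")
      case True
      then show ?thesis using zz(1,2) r by (auto simp: Q_def \<rho>_def)
    next
      case False
      obtain u where "u \<in> P" using zz(1) by (auto simp: Q_def P1_def)
      then show ?thesis using coord[OF zz(1)] coord[OF zz(2)] False zz(3) by simp
    qed
  qed auto
  show "\<exists>X. finite X \<and> card X \<le> N1 + N1 + N0 \<and> (\<forall>C. convex C \<and> \<epsilon> \<le> sum w (P \<inter> C) \<longrightarrow> C \<inter> X \<noteq> {})"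
  proof (intro exI[of _ "X1 \<union> X2 \<union> X0"] conjI allI impI; (elim conjE)?)
    show "card (X1 \<union> X2 \<union> X0) \<le> N1 + N1 + N0"
      using X1(2) X2(2) X0(2) card_Un_le[of X1 X2] card_Un_le[of "X1 \<union> X2" X0] by linarith
  next
    fix C :: "'a set" assume C: "convex C" "\<epsilon> \<le> sum w (P \<inter> C)"
    have "P \<inter> C = ({x\<in>P. x \<bullet> b < m} \<inter> C) \<union> (P2 \<inter> C)" by (auto simp: P2_def)
    then have split1: "sum w (P \<inter> C) = sum w ({x\<in>P. x \<bullet> b < m} \<inter> C) + sum w (P2 \<inter> C)"
      using P by (simp only:) (rule sum.union_disjoint, auto simp: P2_def)
    have "P \<inter> C = ({x\<in>P. m < x \<bullet> b} \<inter> C) \<union> (P1 \<inter> C)" by (auto simp: P1_def)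
    then have split2: "sum w (P \<inter> C) = sum w ({x\<in>P. m < x \<bullet> b} \<inter> C) + sum w (P1 \<inter> C)"
      using P by (simp only:) (rule sum.union_disjoint, auto simp: P1_def)
    \<comment> \<open>In the first two cases the opposite open side carries more than
      \<open>3/4 * \<epsilon>\<close>. In the third, pairs of total product weight at least
      \<open>(\<epsilon> / 4)\<^sup>2\<close> have both ends in \<open>C\<close>.\<close>
    consider "sum w (P1 \<inter> C) < \<epsilon> / 4" | "sum w (P2 \<inter> C) < \<epsilon> / 4"
      | "\<epsilon> / 4 \<le> sum w (P1 \<inter> C)" "\<epsilon> / 4 \<le> sum w (P2 \<inter> C)" by linarith
    then have "C \<inter> X1 \<noteq> {} \<or> C \<inter> X2 \<noteq> {} \<or> C \<inter> X0 \<noteq> {}"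
    proof cases
      case 1
      then show ?thesis using X2(3)[OF C(1)] split2 C(2) by auto
    next
      case 2
      then show ?thesis using X1(3)[OF C(1)] split1 C(2) by auto
    next
      case 3
      have "\<epsilon>\<^sup>2 / 16 = (\<epsilon> / 4) * (\<epsilon> / 4)" by (simp add: power2_eq_square)
      also have "\<dots> \<le> sum w (P1 \<inter> C) * sum w (P2 \<inter> C)"
        using 3 \<epsilon> by (intro mult_mono) auto
      also have "\<dots> = sum ww ((P1 \<inter> C) \<times> (P2 \<inter> C))" by (simp add: ww_prod)
      also have "\<dots> \<le> sum ww {t \<in> P1 \<times> P2. \<rho> t \<in> C}"
      proof (rule sum_mono2)
        show "(P1 \<inter> C) \<times> (P2 \<inter> C) \<subseteq> {t \<in> P1 \<times> P2. \<rho> t \<in> C}"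
          using r closed_segment_subset[OF _ _ C(1)] by (fastforce simp: \<rho>_def)
      qed (use fin12 ww0 in auto)
      also have "\<dots> = sum w' (Q \<inter> C)" by (simp add: w'_sum)
      finally show ?thesis using X0(3)[OF C(1)] by blast
    qed
    then show "C \<inter> (X1 \<union> X2 \<union> X0) \<noteq> {}" by blast
  qed (use X1 X2 X0 in auto)
qed

text \<open>The cutting step reduces \<open>\<epsilon>\<close> to the larger threshold
  \<open>3/2 * \<epsilon>\<close> with the same coordinates and to a smaller one with a coordinate
  fewer. Hence two nested inductions: on the coordinates, and on the number of factors
  \<open>2/3\<close> separating \<open>\<epsilon>\<close> from a trivial threshold.\<close>

lemma weak_net_bound_exists:
  fixes B :: "'a::euclidean_space set"
  assumes "finite B" "0 < \<epsilon>"
  shows "\<exists>N. weak_net_bound B \<epsilon> N"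
  using assms
proof (induction B arbitrary: \<epsilon> rule: finite_induct)
  case empty
  \<comment> \<open>Without free coordinates \<open>P\<close> has at most one point and is its own
    net.\<close>
  have "weak_net_bound ({}::'a set) \<epsilon> 1"
    unfolding weak_net_bound_def
  proof (intro allI impI, elim conjE)
    fix P :: "'a set" and w :: "'a \<Rightarrow> real"
    assume P: "\<forall>x\<in>P. \<forall>y\<in>P. \<forall>b\<in>Basis - {}. x \<bullet> b = y \<bullet> b"
    show "\<exists>X. finite X \<and> card X \<le> 1 \<and> (\<forall>C. convex C \<and> \<epsilon> \<le> sum w (P \<inter> C) \<longrightarrow> C \<inter> X \<noteq> {})"
    proof (intro exI[of _ P] conjI allI impI)
      have "x = y" if "x \<in> P" "y \<in> P" for x y
      proof (rule euclidean_eqI)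
        show "x \<bullet> b = y \<bullet> b" if "b \<in> Basis" for b
          using P \<open>x \<in> P\<close> \<open>y \<in> P\<close> that by blast
      qed
      then have "P = {} \<or> (\<exists>x. P = {x})" by blast
      then show "finite P" "card P \<le> 1" by auto
      show "C \<inter> P \<noteq> {}" if "convex C \<and> \<epsilon> \<le> sum w (P \<inter> C)" for C
      proof
        assume "C \<inter> P = {}"
        then have "P \<inter> C = {}" by blast
        then show False using that empty by (metis sum.empty not_le)
      qed
    qed
  qed
  then show ?case by blast
next
  case (insert b B)
  have "\<exists>N. weak_net_bound (insert b B) (2 * (2/3) ^ j) N" for j
  proof (induction j)
    case 0
    \<comment> \<open>The threshold 2 exceeds the total weight, so no set qualifies and the empty
      net suffices.\<close>
    have "weak_net_bound (insert b B) 2 0"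
      unfolding weak_net_bound_def
    proof (intro allI impI exI[of _ "{}"] conjI; (elim conjE)?)
      fix P C :: "'a set" and w :: "'a \<Rightarrow> real"
      assume "finite P" "\<forall>x\<in>P. 0 \<le> w x" "sum w P \<le> 1" "2 \<le> sum w (P \<inter> C)"
      moreover have "sum w (P \<inter> C) \<le> sum w P"
        using calculation by (intro sum_mono2) auto
      ultimately show "C \<inter> {} \<noteq> {}" by simp
    qed auto
    then show ?case by auto
  next
    case (Suc j)
    then obtain N1 where "weak_net_bound (insert b B) (3/2 * (2 * (2/3) ^ Suc j)) N1" by auto
    moreover obtain N0 where "weak_net_bound B ((2 * (2/3) ^ Suc j)\<^sup>2 / 16) N0"
      using insert.IH[of "(2 * (2/3) ^ Suc j)\<^sup>2 / 16"] by auto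
    ultimately show ?case
      using weak_net_bound_step[of b B "2 * (2/3) ^ Suc j" N1 N0] zero_less_power[of "2/3::real" "Suc j"] by (metis mult_pos_pos zero_less_numeral zero_less_divide_iff)
  qed
  moreover obtain j where "(2/3::real) ^ j < \<epsilon> / 2"
    using real_arch_pow_inv[of "\<epsilon> / 2" "2/3"] insert.prems by auto
  moreover have "weak_net_bound (insert b B) \<epsilon> N" if Nj: "weak_net_bound (insert b B) (2 * (2/3) ^ j) N" for N
    unfolding weak_net_bound_def
  proof (intro allI impI)
    fix P :: "'a set" and w :: "'a \<Rightarrow> real"
    assume Pw: "finite P \<and> (\<forall>x\<in>P. 0 \<le> w x) \<and> sum w P \<le> 1 \<and>
      (\<forall>x\<in>P. \<forall>y\<in>P. \<forall>b'\<in>Basis - insert b B. x \<bullet> b' = y \<bullet> b')"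
    obtain X where "finite X" "card X \<le> N"
      "\<forall>C. convex C \<and> 2 * (2/3) ^ j \<le> sum w (P \<inter> C) \<longrightarrow> C \<inter> X \<noteq> {}"
      using Nj[unfolded weak_net_bound_def, rule_format, OF Pw] by blast
    moreover have "2 * (2/3) ^ j \<le> \<epsilon>" using \<open>(2/3::real) ^ j < \<epsilon> / 2\<close> by simp
    ultimately show "\<exists>X. finite X \<and> card X \<le> N \<and> (\<forall>C. convex C \<and> \<epsilon> \<le> sum w (P \<inter> C) \<longrightarrow> C \<inter> X \<noteq> {})"
      by (intro exI[of _ X]) auto
  qed
  ultimately show ?case by blast
qed

section \<open>Transversals of several kinds\<close>

text \<open>The bound \<open>c\<close> is the number of kinds times the size of one weak net, both
  fixed before \<open>F\<close> and \<open>C\<close>; neither the size of the family nor the length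
  of the sequence of points enters.\<close>

lemma convex_sets_transversal:
  fixes S :: "'v \<Rightarrow> 'a::euclidean_space set" and m N :: nat
  assumes V: "finite V" and N: "2 \<le> N" and S: "\<And>v. v \<in> V \<Longrightarrow> dim (S v) < N"
  shows "\<exists>c. \<forall>F (C :: 'v \<Rightarrow> 'b \<Rightarrow> 'a set). finite F \<and>
      (\<forall>v\<in>V. \<forall>A\<in>F. convex (C v A) \<and> C v A \<subseteq> S v) \<and>
      (\<forall>f\<in>{..<m} \<rightarrow> F. \<exists>I\<subseteq>{..<m}. card I = N \<and> (\<exists>v\<in>V. (\<Inter>i\<in>I. C v (f i)) \<noteq> {})) \<longrightarrow>
      (\<exists>X. (\<forall>v\<in>V. finite (X v)) \<and> (\<Sum>v\<in>V. card (X v)) \<le> c \<and> (\<forall>A\<in>F. \<exists>v\<in>V. C v A \<inter> X v \<noteq> {}))"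
proof -
  define L where "L = card V * m * 2 ^ m"
  \<comment> \<open>Each member will contain \<open>1 / (2 * L)\<close> of the points of the
    sequence, hence for some kind a fraction \<open>1 / (2 * L * card V)\<close> of all of them. The
    extra summand only keeps \<open>\<epsilon>\<close> positive when \<open>L = 0\<close>.\<close>
  define \<epsilon> where "\<epsilon> = 1 / (2 * real L * real (card V) + (if L = 0 then 1 else 0))"
  have "0 < \<epsilon>" by (auto simp: \<epsilon>_def L_def)
  then obtain n where n: "weak_net_bound (Basis :: 'a set) \<epsilon> n"
    using weak_net_bound_exists[OF finite_Basis] by blast
  show ?thesis
  proof (rule exI[of _ "card V * n"], intro allI impI, elim conjE)
    fix F :: "'b set" and C :: "'v \<Rightarrow> 'b \<Rightarrow> 'a set"
    assume F: "finite F" and C: "\<forall>v\<in>V. \<forall>A\<in>F. convex (C v A) \<and> C v A \<subseteq> S v"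
      and hyp: "\<forall>f\<in>{..<m} \<rightarrow> F. \<exists>I\<subseteq>{..<m}. card I = N \<and> (\<exists>v\<in>V. (\<Inter>i\<in>I. C v (f i)) \<noteq> {})"
    show "\<exists>X. (\<forall>v\<in>V. finite (X v)) \<and> (\<Sum>v\<in>V. card (X v)) \<le> card V * n \<and> (\<forall>A\<in>F. \<exists>v\<in>V. C v A \<inter> X v \<noteq> {})"
    proof (cases "F = {}")
      case True
      then show ?thesis by (intro exI[of _ "\<lambda>_. {}"]) auto
    next
      case False
      \<comment> \<open>A constant tuple turns \<open>hyp\<close> into an index set of size
        \<open>N \<ge> 2\<close> and a kind, so \<open>m\<close>, \<open>card V\<close> and
        \<open>L\<close> are positive.\<close>
      then obtain A0 where "(\<lambda>_. A0) \<in> {..<m} \<rightarrow> F" by auto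
      with hyp obtain I v where "I \<subseteq> {..<m}" "card I = N" "v \<in> V" by meson
      then have "m \<noteq> 0" "V \<noteq> {}" using N by (cases m; auto)+
      then have L: "0 < L" using V by (auto simp: L_def card_gt_0_iff)
      have cV: "0 < card V" using V \<open>V \<noteq> {}\<close> by (simp add: card_gt_0_iff)
      \<comment> \<open>Least-norm points need closed sets, but \<open>C v A\<close> may fail to be
        closed. The hulls \<open>D v A\<close> of finitely many chosen points, one per subfamily
        with a common point, are compact, lie in \<open>C v A\<close>, and have a common point
        whenever the original sets do.\<close>
      define pt where "pt v J = (SOME x. x \<in> (\<Inter>A\<in>J. C v A))" for v J
      have pt: "pt v J \<in> C v A" if "A \<in> J" "(\<Inter>A\<in>J. C v A) \<noteq> {}" for v J A
        using someI_ex[of "\<lambda>x. x \<in> (\<Inter>A\<in>J. C v A)"] that unfolding pt_def by blast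
      define D where "D v A = convex hull (pt v ` {J. J \<subseteq> F \<and> A \<in> J \<and> (\<Inter>A\<in>J. C v A) \<noteq> {}})" for v A
      have DC: "D v A \<subseteq> C v A" if "v \<in> V" "A \<in> F" for v A
        unfolding D_def
      proof (rule hull_minimal)
        show "pt v ` {J. J \<subseteq> F \<and> A \<in> J \<and> (\<Inter>A\<in>J. C v A) \<noteq> {}} \<subseteq> C v A" using pt by blast
      qed (use C that in blast)
      have clD: "closed (D v A)" "convex (D v A)" for v A
      proof -
        have "finite {J. J \<subseteq> F \<and> A \<in> J \<and> (\<Inter>A\<in>J. C v A) \<noteq> {}}"
          by (rule finite_subset[of _ "Pow F"]) (use F in auto)
        then show "closed (D v A)" unfolding D_def
          by (intro compact_imp_closed finite_imp_compact_convex_hull finite_imageI)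
      qed (simp add: D_def)
      have hypD: "\<exists>I\<subseteq>{..<m}. card I = N \<and> (\<exists>v\<in>V. (\<Inter>i\<in>I. D v (f i)) \<noteq> {})" if f: "f \<in> {..<m} \<rightarrow> F" for f
      proof -
        obtain I v where I: "I \<subseteq> {..<m}" "card I = N" "v \<in> V" "(\<Inter>i\<in>I. C v (f i)) \<noteq> {}"
          using hyp f by blast
        have "f ` I \<subseteq> F" using f I by auto
        then have "pt v (f ` I) \<in> D v (f i)" if "i \<in> I" for i
          unfolding D_def using I that by (intro hull_inc imageI) auto
        then show ?thesis using I by blast
      qed
      define hit where "hit = (\<lambda>(v, z) A. v \<in> V \<and> z \<in> D v A)"
      have "\<exists>x. sum w F \<le> L * sum w {A\<in>F. hit x A}" if w: "0 < sum w F" for w :: "'b \<Rightarrow> nat"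
      proof -
        \<comment> \<open>Weights become multiplicities: \<open>U\<close> holds \<open>w A\<close>
          copies of each \<open>A\<close>.\<close>
        define U where "U = Sigma F (\<lambda>A. {..<w A})"
        have cU: "card U = sum w F" "finite U" using F by (auto simp: U_def)
        have "\<exists>v\<in>V. \<exists>z. card U \<le> (card V * m * 2 ^ m) * card {u\<in>U. z \<in> D v (fst u)}"
        proof (rule exists_heavy_point[OF _ _ V N])
          show "finite U" "U \<noteq> {}" using cU w by auto
          show "closed (D v (fst u)) \<and> convex (D v (fst u)) \<and> D v (fst u) \<subseteq> S v"
            if "v \<in> V" "u \<in> U" for v u
          proof -
            have "fst u \<in> F" using that(2) by (auto simp: U_def)
            then show ?thesis using clD DC C that(1) by blast
          qed
          show "\<exists>I\<subseteq>{..<m}. card I = N \<and> (\<exists>v\<in>V. (\<Inter>i\<in>I. D v (fst (f i))) \<noteq> {})"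
            if "f \<in> {..<m} \<rightarrow> U" for f
          proof (rule hypD)
            show "(\<lambda>i. fst (f i)) \<in> {..<m} \<rightarrow> F" using that unfolding U_def Pi_iff by (metis SigmaE fst_conv)
          qed
        qed (rule S)
        then obtain v z where vz: "v \<in> V" "card U \<le> L * card {u\<in>U. z \<in> D v (fst u)}"
          unfolding L_def by blast
        have "{u\<in>U. z \<in> D v (fst u)} = Sigma {A\<in>F. hit (v, z) A} (\<lambda>A. {..<w A})"
          using vz(1) by (auto simp: U_def hit_def)
        then have "card {u\<in>U. z \<in> D v (fst u)} = sum w {A\<in>F. hit (v, z) A}"
          using F by simp
        then show ?thesis using vz(2) cU by metis
      qed
      from multiplicative_weights[OF F False L this] obtain T and x :: "nat \<Rightarrow> 'v \<times> 'a" where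
        T: "0 < T" "\<forall>A\<in>F. T \<le> 2 * L * card {t. t < T \<and> hit (x t) A}" by blast
      define \<tau> where "\<tau> v = {t. t < T \<and> fst (x t) = v}" for v
      \<comment> \<open>The distribution of the points of kind \<open>v\<close> is normalised by the
        full length \<open>T\<close>, so its total is at most 1.\<close>
      define \<mu> where "\<mu> v z = real (card {t \<in> \<tau> v. snd (x t) = z}) / T" for v z
      define P where "P v = (\<lambda>t. snd (x t)) ` \<tau> v" for v
      have \<tau>: "finite (\<tau> v)" for v by (simp add: \<tau>_def)
      have sum\<mu>: "sum (\<mu> v) (P v \<inter> E) = real (card {t \<in> \<tau> v. snd (x t) \<in> E}) / T" for v E
      proof -
        have "real (card {t \<in> \<tau> v. snd (x t) \<in> E}) = (\<Sum>t \<in> {t \<in> \<tau> v. snd (x t) \<in> E}. 1)" by simp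
        also have "\<dots> = (\<Sum>z \<in> (\<lambda>t. snd (x t)) ` {t \<in> \<tau> v. snd (x t) \<in> E}.
            \<Sum>t \<in> {t \<in> {t \<in> \<tau> v. snd (x t) \<in> E}. snd (x t) = z}. 1)"
          using \<tau> by (intro sum.image_gen) auto
        also have "\<dots> = (\<Sum>z \<in> P v \<inter> E. real (card {t \<in> \<tau> v. snd (x t) = z}))"
        proof (rule sum.cong)
          fix z assume "z \<in> P v \<inter> E"
          then have "{t \<in> {t \<in> \<tau> v. snd (x t) \<in> E}. snd (x t) = z} = {t \<in> \<tau> v. snd (x t) = z}" by auto
          then show "(\<Sum>t \<in> {t \<in> {t \<in> \<tau> v. snd (x t) \<in> E}. snd (x t) = z}. 1)
            = real (card {t \<in> \<tau> v. snd (x t) = z})" by simp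
        qed (auto simp: P_def)
        finally show ?thesis by (simp add: \<mu>_def sum_divide_distrib)
      qed
      have "\<exists>X. finite X \<and> card X \<le> n \<and> (\<forall>E. convex E \<longrightarrow> \<epsilon> \<le> sum (\<mu> v) (P v \<inter> E) \<longrightarrow> E \<inter> X \<noteq> {})" for v
      proof -
        have "card (\<tau> v) \<le> T" using card_mono[of "{..<T}" "\<tau> v"] by (auto simp: \<tau>_def)
        then have "sum (\<mu> v) (P v) \<le> 1" using sum\<mu>[of v UNIV] T by simp
        then obtain X where "finite X" "card X \<le> n"
          "\<And>E. convex E \<Longrightarrow> \<epsilon> \<le> sum (\<mu> v) (P v \<inter> E) \<Longrightarrow> E \<inter> X \<noteq> {}"
          by (rule weak_net_boundD[OF n, of "P v" "\<mu> v", rotated 2]) (auto simp: P_def \<tau> \<mu>_def)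
        then show ?thesis by blast
      qed
      then obtain X where X: "\<And>v. finite (X v)" "\<And>v. card (X v) \<le> n"
        "\<And>v E. convex E \<Longrightarrow> \<epsilon> \<le> sum (\<mu> v) (P v \<inter> E) \<Longrightarrow> E \<inter> X v \<noteq> {}"
        by metis
      have "\<exists>v\<in>V. C v A \<inter> X v \<noteq> {}" if A: "A \<in> F" for A
      proof -
        define H where "H = {t. t < T \<and> hit (x t) A}"
        have TH: "T \<le> 2 * L * card H" using T(2) A by (simp add: H_def)
        have "\<exists>v\<in>V. card H \<le> card V * card {t\<in>H. fst (x t) = v}"
        proof (rule pigeonhole_card[OF V])
          show "finite H" by (simp add: H_def)
          show "H \<noteq> {}" using TH T(1) by auto
        qed (auto simp: H_def hit_def)
        then obtain v where v: "v \<in> V" "card H \<le> card V * card {t\<in>H. fst (x t) = v}" by blast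
        have "{t\<in>H. fst (x t) = v} = {t \<in> \<tau> v. snd (x t) \<in> D v A}"
          using v(1) by (auto simp: H_def hit_def \<tau>_def case_prod_beta)
        with v(2) have "card H \<le> card V * card {t \<in> \<tau> v. snd (x t) \<in> D v A}" by simp
        then have "T \<le> 2 * L * (card V * card {t \<in> \<tau> v. snd (x t) \<in> D v A})"
          using TH by (meson le_trans mult_le_mono2)
        then have "real T \<le> 2 * real L * real (card V) * real (card {t \<in> \<tau> v. snd (x t) \<in> D v A})"
          by (metis (no_types, lifting) mult.assoc of_nat_le_iff of_nat_mult of_nat_numeral)
        then have "\<epsilon> \<le> sum (\<mu> v) (P v \<inter> D v A)"
          unfolding sum\<mu> \<epsilon>_def using T(1) L cV by (simp add: field_simps)
        then have "D v A \<inter> X v \<noteq> {}" using X(3) clD by blast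
        then show ?thesis using DC v(1) A by blast
      qed
      moreover have "(\<Sum>v\<in>V. card (X v)) \<le> card V * n"
        using sum_bounded_above[of V "\<lambda>v. card (X v)" n] X(2) by simp
      ultimately show ?thesis using X(1) by blast
    qed
  qed
qed

section \<open>Segments of prescribed extent in a direction\<close>

text \<open>
  The pair \<open>(x, z)\<close> encodes the segment from \<open>x\<close> to \<open>z + t *\<^sub>R v\<close>; subtracting \<open>t *\<^sub>R v\<close> makes the
  condition on the extent linear, so that all pairs lie in one hyperplane through the origin.
\<close>
definition segment_pairs :: "'a::euclidean_space \<Rightarrow> real \<Rightarrow> 'a set \<Rightarrow> ('a \<times> 'a) set" where
  "segment_pairs v t A = {(x, z). x \<in> A \<and> z + t *\<^sub>R v \<in> A \<and> (z - x) \<bullet> v = 0}"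

lemma convex_segment_pairs:
  assumes "convex A"
  shows "convex (segment_pairs v t A)"
proof (rule convexI, clarsimp simp: segment_pairs_def, intro conjI)
  fix x z x' z' :: 'a and a b :: real
  assume *: "0 \<le> a" "0 \<le> b" "a + b = 1" "x \<in> A" "x' \<in> A" "z + t *\<^sub>R v \<in> A" "z' + t *\<^sub>R v \<in> A"
    "(z - x) \<bullet> v = 0" "(z' - x') \<bullet> v = 0"
  show "a *\<^sub>R x + b *\<^sub>R x' \<in> A" using * assms by (simp add: convexD)
  have "a *\<^sub>R (z + t *\<^sub>R v) + b *\<^sub>R (z' + t *\<^sub>R v) = a *\<^sub>R z + b *\<^sub>R z' + ((a + b) * t) *\<^sub>R v"
    by (simp add: algebra_simps)
  then show "a *\<^sub>R z + b *\<^sub>R z' + t *\<^sub>R v \<in> A"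
    using * convexD[OF assms *(6,7), of a b] by simp
  have "(a *\<^sub>R z + b *\<^sub>R z' - (a *\<^sub>R x + b *\<^sub>R x')) = a *\<^sub>R (z - x) + b *\<^sub>R (z' - x')"
    by (simp add: algebra_simps)
  then show "(a *\<^sub>R z + b *\<^sub>R z' - (a *\<^sub>R x + b *\<^sub>R x')) \<bullet> v = 0"
    using * by (simp add: inner_add_left)
qed

lemma le_ediameter_closed_segment:
  assumes "(x, z) \<in> segment_pairs v t A" "norm v = 1"
  shows "ennreal t \<le> ediameter (closed_segment x (z + t *\<^sub>R v))"
proof -
  have "t = (z + t *\<^sub>R v - x) \<bullet> v"
  proof -
    have "z + t *\<^sub>R v - x = (z - x) + t *\<^sub>R v" by simp
    then show ?thesis using assms by (simp only: inner_add_left) (simp add: segment_pairs_def dot_square_norm)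
  qed
  also have "\<dots> \<le> dist x (z + t *\<^sub>R v)"
    using norm_cauchy_schwarz[of "z + t *\<^sub>R v - x" v] assms by (simp add: dist_norm norm_minus_commute)
  finally have "ennreal t \<le> ennreal (dist x (z + t *\<^sub>R v))" by (rule ennreal_leI)
  also have "\<dots> \<le> ediameter (closed_segment x (z + t *\<^sub>R v))"
    unfolding ediameter_def by (rule SUP_upper2[of "(x, z + t *\<^sub>R v)"]) auto
  finally show ?thesis .
qed

text \<open>Two points of \<open>A\<close> more than \<open>1 - \<delta> / 2\<close> apart span a
  direction \<open>u\<close> with \<open>u \<bullet> v \<ge> 1 - \<delta> / 2\<close> for some
  \<open>v\<close> in the net. Their extent along \<open>v\<close> is at least
  \<open>(1 - \<delta> / 2)\<^sup>2 \<ge> 1 - \<delta>\<close>, and convexity allows shortening it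
  to exactly \<open>1 - \<delta>\<close>.\<close>

lemma segment_pairs_nonempty:
  fixes A :: "'a::euclidean_space set"
  assumes \<delta>: "0 < \<delta>" "\<delta> < 1" and A: "convex A" "1 \<le> ediameter A"
    and V: "V \<subseteq> sphere 0 1" "sphere 0 1 \<subseteq> (\<Union>v\<in>V. ball v (\<delta> / 2))"
  shows "\<exists>v\<in>V. segment_pairs v (1 - \<delta>) A \<noteq> {}"
proof -
  \<comment> \<open>The supremum need not be attained, so half of the slack \<delta> is spent on the
    length and half on the direction.\<close>
  have "ennreal (1 - \<delta> / 2) < 1" using \<delta> by (simp add: ennreal_less_one_iff)
  then have "ennreal (1 - \<delta> / 2) < ediameter A" using A(2) by (rule less_le_trans)
  then obtain x y where xy: "x \<in> A" "y \<in> A" "ennreal (1 - \<delta> / 2) < ennreal (dist x y)"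
    unfolding ediameter_def less_SUP_iff by auto
  then have d: "1 - \<delta> / 2 < norm (y - x)"
    using \<delta> by (simp add: ennreal_less_iff dist_norm norm_minus_commute)
  define u where "u = sgn (y - x)"
  have "y \<noteq> x" using d \<delta> by auto
  then have u: "norm u = 1" "y - x = norm (y - x) *\<^sub>R u" by (simp_all add: u_def norm_sgn sgn_div_norm)
  then obtain v where v: "v \<in> V" "dist v u < \<delta> / 2" using V(2) by (auto simp: subset_iff)
  have "u \<bullet> v = 1 - u \<bullet> (u - v)" using u(1) by (simp add: inner_diff_right dot_square_norm)
  moreover have "u \<bullet> (u - v) \<le> \<delta> / 2"
    using norm_cauchy_schwarz[of u "u - v"] u(1) v(2) by (simp add: dist_norm norm_minus_commute)
  ultimately have uv: "1 - \<delta> / 2 \<le> u \<bullet> v" by simp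
  have "1 - \<delta> \<le> (1 - \<delta> / 2) * (1 - \<delta> / 2)" by (simp add: algebra_simps)
  also have "\<dots> \<le> norm (y - x) * (u \<bullet> v)" using uv d \<delta> by (intro mult_mono) auto
  also have "\<dots> = (y - x) \<bullet> v" by (metis inner_scaleR_left u(2))
  finally have ge: "1 - \<delta> \<le> (y - x) \<bullet> v" .
  define s where "s = (1 - \<delta>) / ((y - x) \<bullet> v)"
  have s: "0 \<le> s" "s \<le> 1" "s * ((y - x) \<bullet> v) = 1 - \<delta>" using ge \<delta> by (auto simp: s_def)
  define z where "z = x + s *\<^sub>R (y - x) - (1 - \<delta>) *\<^sub>R v"
  have zv: "z + (1 - \<delta>) *\<^sub>R v = (1 - s) *\<^sub>R x + s *\<^sub>R y" by (simp add: z_def algebra_simps)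
  then have "z + (1 - \<delta>) *\<^sub>R v \<in> A"
    using convexD[OF A(1) xy(1,2), of "1 - s" s] s by simp
  moreover have "(z - x) \<bullet> v = 0"
  proof -
    have "v \<bullet> v = 1" using V(1) v(1) by (auto simp: dot_square_norm)
    have "z - x = s *\<^sub>R (y - x) - (1 - \<delta>) *\<^sub>R v" by (simp add: z_def)
    then have "(z - x) \<bullet> v = s * ((y - x) \<bullet> v) - (1 - \<delta>) * (v \<bullet> v)"
      by (simp only: inner_diff_left inner_scaleR_left)
    then show ?thesis using s(3) \<open>v \<bullet> v = 1\<close> by simp
  qed
  ultimately have "(x, z) \<in> segment_pairs v (1 - \<delta>) A" using xy by (simp add: segment_pairs_def)
  then show ?thesis using v(1) by blast
qed

text \<open>These pairs form the hyperplane with normal \<open>(- v, v)\<close> in a space of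
  dimension \<open>2 * DIM('a)\<close>; this is where the Helly number \<open>2d\<close> comes
  from.\<close>

lemma dim_orthogonal_pairs:
  fixes v :: "'a::euclidean_space"
  assumes "norm v = 1"
  shows "dim {(x, z). (z - x) \<bullet> v = 0} = 2 * DIM('a) - 1"
proof -
  have "{(x, z). (z - x) \<bullet> v = 0} = {p. (- v, v) \<bullet> p = 0}"
    by (auto simp: inner_prod_def inner_diff_left inner_commute[of v])
  moreover have "(- v, v) \<noteq> 0" using assms by (auto simp: zero_prod_def)
  ultimately show ?thesis using dim_hyperplane[of "(- v, v)"] by (simp add: mult_2)
qed

lemma finite_sphere_net:
  fixes \<epsilon> :: real
  assumes "0 < \<epsilon>"
  obtains V :: "'a::euclidean_space set" where "finite V" "V \<subseteq> sphere 0 1" "sphere 0 1 \<subseteq> (\<Union>v\<in>V. ball v \<epsilon>)"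
  using seq_compact_imp_totally_bounded[OF compact_imp_seq_compact[OF compact_sphere]] assms by metis

section \<open>From transversals of segment pairs to the (p,q) theorem for diameters\<close>

theorem theorem1p1:
  fixes p q :: nat and \<delta> :: real
  assumes "p \<ge> q" and "q \<ge> 2 * CARD('d::finite)" and "0 < \<delta>" and "\<delta> < 1"
  shows "\<exists>c::nat. c > 0 \<and>
    (\<forall>F :: (real ^ 'd) set set.
       finite F \<and> card F \<ge> p \<and>
       (\<forall>A\<in>F. convex A \<and> ediameter A \<ge> 1) \<and>
       (\<forall>G. G \<subseteq> F \<and> card G = p \<longrightarrow> (\<exists>H. H \<subseteq> G \<and> card H = q \<and> ediameter (\<Inter>H) \<ge> 1))
       \<longrightarrow> (\<exists>K :: nat \<Rightarrow> (real ^ 'd) set.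
             (\<forall>i\<in>{1..c}. convex (K i) \<and> ediameter (K i) \<ge> ennreal (1 - \<delta>)) \<and>
             (\<forall>A\<in>F. \<exists>i\<in>{1..c}. K i \<subseteq> A)))"
proof -
  define N where "N = 2 * CARD('d)"
  \<comment> \<open>Among \<open>p * N\<close> entries, either \<open>p\<close> are distinct or one
    set is repeated at least \<open>N\<close> times.\<close>
  define m where "m = p * N"
  define t where "t = 1 - \<delta>"
  have N: "2 \<le> N" by (simp add: N_def)
  have pq: "N \<le> q" "0 < p" using assms N unfolding N_def by linarith+
  obtain V :: "(real ^ 'd) set" where V: "finite V" "V \<subseteq> sphere 0 1"
    "sphere 0 1 \<subseteq> (\<Union>v\<in>V. ball v (\<delta> / 2))"
    using finite_sphere_net[of "\<delta> / 2"] assms by auto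
  have nV: "norm v = 1" if "v \<in> V" for v using V(2) that by auto
  define S :: "real ^ 'd \<Rightarrow> ((real ^ 'd) \<times> (real ^ 'd)) set" where "S v = {(x, z). (z - x) \<bullet> v = 0}" for v
  have S: "dim (S v) < N" if "v \<in> V" for v
    using dim_orthogonal_pairs[OF nV[OF that]] by (simp add: S_def N_def)
  have dir: "\<exists>v\<in>V. segment_pairs v t A \<noteq> {}" if "convex A" "1 \<le> ediameter A" for A
    unfolding t_def using segment_pairs_nonempty[OF assms(3,4) that V(2,3)] .
  from convex_sets_transversal[OF V(1) N S, where m = m]
  obtain c where c: "\<forall>F (C :: real ^ 'd \<Rightarrow> (real ^ 'd) set \<Rightarrow> ((real ^ 'd) \<times> (real ^ 'd)) set). finite F \<and>
      (\<forall>v\<in>V. \<forall>A\<in>F. convex (C v A) \<and> C v A \<subseteq> S v) \<and>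
      (\<forall>f\<in>{..<m} \<rightarrow> F. \<exists>I\<subseteq>{..<m}. card I = N \<and> (\<exists>v\<in>V. (\<Inter>i\<in>I. C v (f i)) \<noteq> {})) \<longrightarrow>
      (\<exists>X. (\<forall>v\<in>V. finite (X v)) \<and> (\<Sum>v\<in>V. card (X v)) \<le> c \<and> (\<forall>A\<in>F. \<exists>v\<in>V. C v A \<inter> X v \<noteq> {}))"
    by (rule exE)
  show ?thesis
  \<comment> \<open>The successor makes the count positive even if \<open>c = 0\<close>.\<close>
  proof (intro exI[of _ "Suc c"] conjI allI impI; (elim conjE)?)
    fix F :: "(real ^ 'd) set set"
    assume F: "finite F" "p \<le> card F"
      and FA: "\<forall>A\<in>F. convex A \<and> 1 \<le> ediameter A"
      and FG: "\<forall>G. G \<subseteq> F \<and> card G = p \<longrightarrow> (\<exists>H. H \<subseteq> G \<and> card H = q \<and> 1 \<le> ediameter (\<Inter>H))"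
    have tuples: "\<exists>I\<subseteq>{..<m}. card I = N \<and> (\<exists>v\<in>V. (\<Inter>i\<in>I. segment_pairs v t (f i)) \<noteq> {})"
      if f: "f \<in> {..<m} \<rightarrow> F" for f
    proof -
      have common: ?thesis
        if I: "I \<subseteq> {..<m}" "card I = N" and H: "H \<subseteq> F" "1 \<le> ediameter (\<Inter>H)" and fI: "f ` I \<subseteq> H" for I H
      proof -
        have "convex (\<Inter>H)" using FA H by (intro convex_Inter) auto
        then obtain v where "v \<in> V" "segment_pairs v t (\<Inter>H) \<noteq> {}" using dir H by blast
        moreover have "segment_pairs v t (\<Inter>H) \<subseteq> (\<Inter>i\<in>I. segment_pairs v t (f i))"
          using fI by (auto simp: segment_pairs_def)
        ultimately show ?thesis using I by blast
      qed
      show ?thesis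
      proof (cases "p \<le> card (f ` {..<m})")
        case True
        then obtain G where G: "G \<subseteq> f ` {..<m}" "card G = p"
          by (meson obtain_subset_with_card_n)
        have "f ` {..<m} \<subseteq> F" using f by auto
        with G have "G \<subseteq> F \<and> card G = p" by blast
        with FG obtain H where H: "H \<subseteq> G" "card H = q" "1 \<le> ediameter (\<Inter>H)" by blast
        then obtain H' where H': "H' \<subseteq> H" "card H' = N"
          using pq(1) by (metis obtain_subset_with_card_n)
        then have "H' \<subseteq> f ` {..<m}" using H G by blast
        then obtain I where I: "I \<subseteq> {..<m}" "inj_on f I" "H' = f ` I"
          by (meson subset_image_inj)
        show ?thesis
        proof (rule common[of I H])
          show "card I = N" using I H' by (simp add: card_image)
          show "H \<subseteq> F" using H G \<open>f ` {..<m} \<subseteq> F\<close> by blast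
        qed (use I H H' in auto)
      next
        case False
        \<comment> \<open>With fewer than \<open>p\<close> distinct entries some \<open>A\<close>
          fills \<open>N\<close> positions, and the diameter of \<open>A\<close> itself provides the
          common segment.\<close>
        have "\<exists>A\<in>f ` {..<m}. card {..<m} \<le> card (f ` {..<m}) * card {i\<in>{..<m}. f i = A}"
          by (rule pigeonhole_card) (use N pq in \<open>auto simp: m_def lessThan_empty_iff\<close>)
        then obtain A where A: "A \<in> F" "p * N \<le> card (f ` {..<m}) * card {i\<in>{..<m}. f i = A}"
          using f by (auto simp: m_def)
        note A(2)
        also have "\<dots> \<le> p * card {i\<in>{..<m}. f i = A}" using False by (intro mult_le_mono1) simp
        finally have "N \<le> card {i\<in>{..<m}. f i = A}" using pq by simp
        then obtain I where I: "I \<subseteq> {i\<in>{..<m}. f i = A}" "card I = N"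
          by (meson obtain_subset_with_card_n)
        then show ?thesis using A FA by (intro common[of I "{A}"]) auto
      qed
    qed
    have "\<exists>X. (\<forall>v\<in>V. finite (X v)) \<and> (\<Sum>v\<in>V. card (X v)) \<le> c \<and>
        (\<forall>A\<in>F. \<exists>v\<in>V. segment_pairs v t A \<inter> X v \<noteq> {})"
      by (rule c[THEN spec, THEN spec, THEN mp]) (use F FA tuples in \<open>auto simp: convex_segment_pairs, auto simp: segment_pairs_def S_def\<close>)
    then obtain X where X: "\<And>v. v \<in> V \<Longrightarrow> finite (X v)" "(\<Sum>v\<in>V. card (X v)) \<le> c"
      "\<And>A. A \<in> F \<Longrightarrow> \<exists>v\<in>V. segment_pairs v t A \<inter> X v \<noteq> {}" by blast
    define seg where "seg v = (\<lambda>(x, z). closed_segment x (z + t *\<^sub>R v))" for v :: "real ^ 'd"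
    \<comment> \<open>Points of \<open>X v\<close> outside \<open>S v\<close> encode segments of the
      wrong extent and are discarded; those that hit a member lie in \<open>S v\<close>
      anyway.\<close>
    define \<K> where "\<K> = (\<Union>v\<in>V. seg v ` (X v \<inter> S v))"
    have "card \<K> \<le> (\<Sum>v\<in>V. card (seg v ` (X v \<inter> S v)))"
      unfolding \<K>_def by (rule card_UN_le[OF V(1)])
    also have "\<dots> \<le> (\<Sum>v\<in>V. card (X v))"
      by (intro sum_mono order_trans[OF card_image_le card_mono]) (use X in auto)
    finally have "card \<K> \<le> c" using X(2) by simp
    have fin: "finite \<K>" unfolding \<K>_def using V X by auto
    have hits: "\<exists>Q\<in>\<K>. Q \<subseteq> A" if A: "A \<in> F" for A
    proof -
      obtain v x z where v: "v \<in> V" "(x, z) \<in> segment_pairs v t A" "(x, z) \<in> X v"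
        using X(3)[OF A] by auto
      then have "(x, z) \<in> X v \<inter> S v" by (simp add: segment_pairs_def S_def)
      then have "seg v (x, z) \<in> \<K>" using v(1) unfolding \<K>_def by blast
      moreover have "seg v (x, z) \<subseteq> A"
        unfolding seg_def prod.case
        by (intro closed_segment_subset) (use v(2) FA A in \<open>auto simp: segment_pairs_def\<close>)
      ultimately show ?thesis by blast
    qed
    have large: "convex Q \<and> ennreal (1 - \<delta>) \<le> ediameter Q" if Q: "Q \<in> \<K>" for Q
    proof -
      obtain v x z where v: "v \<in> V" "(x, z) \<in> S v" "Q = closed_segment x (z + t *\<^sub>R v)"
        using Q by (auto simp: \<K>_def seg_def)
      then have "(x, z) \<in> segment_pairs v t UNIV" by (simp add: segment_pairs_def S_def)
      then show ?thesis using le_ediameter_closed_segment[OF _ nV[OF v(1)]] v(3) by (auto simp: t_def)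
    qed
    have "F \<noteq> {}" using F pq by auto
    then have "\<K> \<noteq> {}" using hits by blast
    then have c1: "1 \<le> card \<K>" using fin by (simp add: Suc_le_eq card_gt_0_iff)
    obtain h where h: "bij_betw h {1..card \<K>} \<K>" using ex_bij_betw_nat_finite_1[OF fin] by blast
    \<comment> \<open>Indices beyond \<open>card \<K>\<close> are padded with the first
      segment.\<close>
    define K where "K i = (if i \<le> card \<K> then h i else h 1)" for i
    have "K i \<in> \<K>" if "i \<in> {1..Suc c}" for i
      using bij_betwE[OF h] that c1 by (auto simp: K_def)
    moreover have "\<exists>i\<in>{1..Suc c}. K i = Q" if Q: "Q \<in> \<K>" for Q
    proof -
      obtain i where "i \<in> {1..card \<K>}" "h i = Q" using h Q by (metis bij_betw_imp_surj_on imageE)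
      then show ?thesis using \<open>card \<K> \<le> c\<close> by (intro bexI[of _ i]) (auto simp: K_def)
    qed
    ultimately show "\<exists>K :: nat \<Rightarrow> (real ^ 'd) set.
        (\<forall>i\<in>{1..Suc c}. convex (K i) \<and> ennreal (1 - \<delta>) \<le> ediameter (K i)) \<and>
        (\<forall>A\<in>F. \<exists>i\<in>{1..Suc c}. K i \<subseteq> A)"
      using large hits by (intro exI[of _ K]) metis
  qed simp
qed

end
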